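(* Let $W$ be a nonempty subset of the free commutative semigroup $X_c^+$, and let $\tau$ be the divisibility relation on the semigroup $S_c(W)$: $(x,y)\in\tau$ if and only if there exists $z\in M_c(W)$ with $x=yz$. Then the partial order induced by $\tau$ on $S_c(W)$ (namely $y\le x$ if and only if $(x,y)\in\tau$, with greatest element $0$) is a semilattice order, i.e. any two elements $x,y$ have a supremum, and $S_c(W)$ with its multiplication and the addition $x+y=\sup\{x,y\}$ is an ai-semiring.
   Context: $X$ is a countably infinite set of letters; $X_c^+$ and $X_c^*$ are the free commutative semigroup and the free commutative monoid on $X$. For $W\subseteq X_c^+$, $W^{\le}$ denotes the set of all nonempty subwords of words in $W$, i.e. all divisors different from the empty word $1$ (in $X_c^*$) of elements of $W$. The semigroup $S_c(W)$ has underlying set $W^{\le}\cup\{0\}$, where $0$ is a multiplicative zero and, for $\mathbf u,\mathbf v\in W^{\le}$, $\mathbf u\cdot\mathbf v=\mathbf u\mathbf v$ if $\mathbf u\mathbf v\in W^{\le}$ and $\mathbf u\cdot\mathbf v=0$ otherwise. $M_c(W)$ is the monoid obtained by also allowing the empty word $1$ as an element, i.e. $M_c(W)=S_c(W)\cup\{1\}$ with $1$ the identity. An ai-semiring is an algebra $(S,+,\cdot)$ with two binary operations such that $(S,+)$ is a commutative idempotent semigroup, $(S,\cdot)$ is a semigroup, and both distributive laws $(x+y)z=xz+yz$, $x(y+z)=xy+xz$ hold. *)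

theory Defs
  imports "HOL-Library.Multiset" "HOL-Library.Countable_Set" "HOL-Algebra.Lattice"
begin

text \<open>
  Commutative words over \<open>X\<close> are finite multisets of letters from \<open>X\<close>; the product of
  words is multiset sum and the empty word is \<open>{#}\<close>.
\<close>

definition free_comm_monoid :: "'a set \<Rightarrow> 'a multiset set" where
  "free_comm_monoid X = {w. set_mset w \<subseteq> X}"

definition free_comm_semigroup :: "'a set \<Rightarrow> 'a multiset set" where
  "free_comm_semigroup X = free_comm_monoid X - {{#}}"

text \<open>
  The alphabet need not be a parameter below: if \<open>w = u + v\<close> is a word over \<open>X\<close>, then so
  are \<open>u\<close> and \<open>v\<close>.
\<close>

definition subwords :: "'a multiset set \<Rightarrow> 'a multiset set" where
  "subwords W = {u. u \<noteq> {#} \<and> (\<exists>w\<in>W. \<exists>v. w = u + v)}"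

datatype 'a elt = Zero | Word "'a multiset"

definition S\<^sub>c :: "'a multiset set \<Rightarrow> 'a elt set" where
  "S\<^sub>c W = Word ` subwords W \<union> {Zero}"

definition M\<^sub>c :: "'a multiset set \<Rightarrow> 'a elt set" where
  "M\<^sub>c W = S\<^sub>c W \<union> {Word {#}}"

fun S_mult :: "'a multiset set \<Rightarrow> 'a elt \<Rightarrow> 'a elt \<Rightarrow> 'a elt" where
  "S_mult W (Word u) (Word v) = (if u + v \<in> subwords W then Word (u + v) else Zero)"
| "S_mult W Zero y = Zero"
| "S_mult W x Zero = Zero"

text \<open>
  \<open>Word {#}\<close> is adjoined as an identity; the case distinction matters because \<open>{#}\<close> is never
  in \<open>subwords W\<close>.
\<close>

definition M_mult :: "'a multiset set \<Rightarrow> 'a elt \<Rightarrow> 'a elt \<Rightarrow> 'a elt" where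
  "M_mult W x y = (if x = Word {#} then y else if y = Word {#} then x else S_mult W x y)"

definition div_rel :: "'a multiset set \<Rightarrow> ('a elt \<times> 'a elt) set" where
  "div_rel W = {(x, y). x \<in> S\<^sub>c W \<and> y \<in> S\<^sub>c W \<and> (\<exists>z\<in>M\<^sub>c W. x = M_mult W y z)}"

text \<open>Note the reversal: \<open>y \<le> x\<close> means \<open>(x, y) \<in> div_rel W\<close>, i.e. \<open>y\<close> divides \<open>x\<close>.\<close>

definition div_order :: "'a multiset set \<Rightarrow> 'a elt gorder" where
  "div_order W = \<lparr>carrier = S\<^sub>c W, eq = (=), le = (\<lambda>y x. (x, y) \<in> div_rel W)\<rparr>"

locale ai_semiring =
  fixes S :: "'s set" and add :: "'s \<Rightarrow> 's \<Rightarrow> 's" (infixl \<open>\<oplus>\<close> 65)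
    and mult :: "'s \<Rightarrow> 's \<Rightarrow> 's" (infixl \<open>\<odot>\<close> 70)
  assumes add_closed: "\<lbrakk>x \<in> S; y \<in> S\<rbrakk> \<Longrightarrow> x \<oplus> y \<in> S"
    and add_assoc: "\<lbrakk>x \<in> S; y \<in> S; z \<in> S\<rbrakk> \<Longrightarrow> (x \<oplus> y) \<oplus> z = x \<oplus> (y \<oplus> z)"
    and add_commute: "\<lbrakk>x \<in> S; y \<in> S\<rbrakk> \<Longrightarrow> x \<oplus> y = y \<oplus> x"
    and add_idem: "x \<in> S \<Longrightarrow> x \<oplus> x = x"
    and mult_closed: "\<lbrakk>x \<in> S; y \<in> S\<rbrakk> \<Longrightarrow> x \<odot> y \<in> S"
    and mult_assoc: "\<lbrakk>x \<in> S; y \<in> S; z \<in> S\<rbrakk> \<Longrightarrow> (x \<odot> y) \<odot> z = x \<odot> (y \<odot> z)"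
    and distrib_right: "\<lbrakk>x \<in> S; y \<in> S; z \<in> S\<rbrakk> \<Longrightarrow> (x \<oplus> y) \<odot> z = x \<odot> z \<oplus> y \<odot> z"
    and distrib_left: "\<lbrakk>x \<in> S; y \<in> S; z \<in> S\<rbrakk> \<Longrightarrow> x \<odot> (y \<oplus> z) = x \<odot> y \<oplus> x \<odot> z"

end

theory Submission
  imports Defs
begin

text \<open>
  On nonzero elements \<open>\<tau>\<close> is reverse inclusion of multisets, so the supremum of two words is their
  multiset union (the least common multiple) when that is again a subword, and \<open>0\<close> otherwise.
  Distributivity is then \<open>(u \<union># v) + t = (u + t) \<union># (v + t)\<close>: since the set of subwords is closed
  under divisors, both sides leave it simultaneously.
\<close>

lemma subwords_iff: "u \<in> subwords W \<longleftrightarrow> u \<noteq> {#} \<and> (\<exists>w\<in>W. u \<subseteq># w)"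
  by (auto simp: subwords_def mset_subset_eq_exists_conv)

lemma subwords_mono:
  assumes "v \<in> subwords W" "u \<subseteq># v" "u \<noteq> {#}"
  shows "u \<in> subwords W"
  using assms by (meson subset_mset.order_trans subwords_iff)

lemma empty_notin_subwords [simp]: "{#} \<notin> subwords W"
  by (simp add: subwords_iff)

lemma Zero_in_S [simp]: "Zero \<in> S\<^sub>c W"
  by (simp add: S\<^sub>c_def)

lemma Word_in_S [simp]: "Word u \<in> S\<^sub>c W \<longleftrightarrow> u \<in> subwords W"
  by (auto simp: S\<^sub>c_def)

lemma S_mult_Zero_right [simp]: "S_mult W x Zero = Zero"
  by (cases x) auto

lemma S_mult_closed [simp]: "S_mult W x y \<in> S\<^sub>c W"
  by (cases x; cases y) auto

lemma S_mult_commute: "S_mult W x y = S_mult W y x"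
  by (cases x; cases y) (auto simp: add.commute)

text \<open>Both bracketings equal \<open>u + v + t\<close> if that is a subword, since the partial
  products are nonempty divisors of it. Otherwise both collapse to \<open>Zero\<close>.\<close>

lemma S_mult_assoc:
  assumes "x \<in> S\<^sub>c W" "y \<in> S\<^sub>c W" "z \<in> S\<^sub>c W"
  shows "S_mult W (S_mult W x y) z = S_mult W x (S_mult W y z)"
proof (cases x; cases y; cases z)
  fix u v t
  assume eq: "x = Word u" "y = Word v" "z = Word t"
  have "u + v \<in> subwords W" "v + t \<in> subwords W" if "u + v + t \<in> subwords W"
    using assms eq that by (auto intro: subwords_mono[OF that] simp: add.assoc)
  then show ?thesis
    by (auto simp: eq add.assoc)
qed auto

lemma div_rel_Zero [simp]: "(Zero, y) \<in> div_rel W \<longleftrightarrow> y \<in> S\<^sub>c W"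
  by (auto simp: div_rel_def M\<^sub>c_def M_mult_def intro!: bexI[of _ Zero])

lemma div_rel_Word_Zero [simp]: "(Word v, Zero) \<notin> div_rel W"
  by (auto simp: div_rel_def M_mult_def)

lemma div_rel_Word_Word [simp]:
  "(Word v, Word u) \<in> div_rel W \<longleftrightarrow> u \<in> subwords W \<and> v \<in> subwords W \<and> u \<subseteq># v"
proof
  assume "(Word v, Word u) \<in> div_rel W"
  then obtain z where "u \<in> subwords W" "v \<in> subwords W" "Word v = M_mult W (Word u) z"
    by (auto simp: div_rel_def)
  then show "u \<in> subwords W \<and> v \<in> subwords W \<and> u \<subseteq># v"
    by (cases z) (auto simp: M_mult_def split: if_splits)
next
  assume uv: "u \<in> subwords W \<and> v \<in> subwords W \<and> u \<subseteq># v"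
  then obtain t where t: "v = u + t"
    by (auto simp: mset_subset_eq_exists_conv)
  \<comment> \<open>As a divisor of \<open>v\<close>, the cofactor \<open>t\<close> is a subword
    unless it is empty; the empty case is covered by the identity adjoined in
    \<open>M\<^sub>c W\<close>.\<close>
  have "t = {#} \<or> t \<in> subwords W"
    using uv t by (auto intro: subwords_mono[of v])
  then have "Word t \<in> M\<^sub>c W"
    by (auto simp: M\<^sub>c_def)
  moreover have "Word v = M_mult W (Word u) (Word t)"
    using uv t by (auto simp: M_mult_def)
  ultimately show "(Word v, Word u) \<in> div_rel W"
    using uv unfolding div_rel_def by (auto simp flip: Word_in_S)
qed

lemma carrier_div_order [simp]: "carrier (div_order W) = S\<^sub>c W"
  by (simp add: div_order_def)

lemma eq_div_order [simp]: "eq (div_order W) = (=)"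
  by (simp add: div_order_def)

lemma le_div_order [simp]: "le (div_order W) y x \<longleftrightarrow> (x, y) \<in> div_rel W"
  by (simp add: div_order_def)

lemma partial_order_div_order: "partial_order (div_order W)"
proof
  fix x y z
  show "le (div_order W) x x" if "x \<in> carrier (div_order W)"
    using that by (cases x) auto
  show "eq (div_order W) x y" if "le (div_order W) x y" "le (div_order W) y x"
    using that by (cases x; cases y) auto
  show "le (div_order W) x z" if "le (div_order W) x y" "le (div_order W) y z"
    "x \<in> carrier (div_order W)"
    using that by (cases x; cases y; cases z) auto
qed auto

lemma greatest_div_order: "greatest (div_order W) Zero (carrier (div_order W))"
  by (simp add: greatest_def)

text \<open>A closed form for the join, which the library defines as \<open>SOME\<close> least upper
  bound: distributivity can then be checked by cases on \<open>Zero\<close> and words.\<close>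

fun lcm_elt :: "'a multiset set \<Rightarrow> 'a elt \<Rightarrow> 'a elt \<Rightarrow> 'a elt" where
  "lcm_elt W (Word u) (Word v) = (if u \<union># v \<in> subwords W then Word (u \<union># v) else Zero)"
| "lcm_elt W Zero y = Zero"
| "lcm_elt W x Zero = Zero"

lemma lcm_elt_Zero_right [simp]: "lcm_elt W x Zero = Zero"
  by (cases x) auto

lemma least_lcm_elt:
  assumes "x \<in> S\<^sub>c W" "y \<in> S\<^sub>c W"
  shows "least (div_order W) (lcm_elt W x y) (Upper (div_order W) {x, y})"
proof (rule least_UpperI)
  show "lcm_elt W x y \<in> carrier (div_order W)"
    by (cases x; cases y) auto
next
  fix s
  assume "s \<in> {x, y}"
  then show "le (div_order W) s (lcm_elt W x y)"
    using assms by (cases x; cases y) auto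
next
  fix z
  assume "z \<in> Upper (div_order W) {x, y}"
  then have z: "(z, x) \<in> div_rel W" "(z, y) \<in> div_rel W" "z \<in> S\<^sub>c W"
    using assms by (auto simp: Upper_def)
  show "le (div_order W) (lcm_elt W x y) z"
  proof (cases z)
    case Zero
    then show ?thesis
      by (cases x; cases y) auto
  next
    case (Word t)
    \<comment> \<open>\<open>Zero\<close> divides no word, so two elements bounded above by a word
      are words themselves.\<close>
    obtain u v where uv: "x = Word u" "y = Word v"
      using z Word by (cases x; cases y) auto
    then have t: "u \<in> subwords W" "t \<in> subwords W" "u \<subseteq># t" "v \<subseteq># t"
      using z unfolding Word by simp_all
    from t(3,4) have "u \<union># v \<subseteq># t"
      by (rule subset_mset.sup_least)
    \<comment> \<open>Nonemptiness makes \<open>u \<union># v\<close>, a divisor of the subword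
      \<open>t\<close>, a subword too. Hence \<open>lcm_elt\<close> takes the default value
      \<open>Zero\<close> only when no word bounds both arguments.\<close>
    moreover have "u \<union># v \<noteq> {#}"
      using t(1) by (auto simp: subwords_iff)
    ultimately show ?thesis
      using t(2) subwords_mono[OF t(2)] by (simp add: Word uv)
  qed
qed (use assms in auto)

lemma upper_semilattice_div_order: "upper_semilattice (div_order W)"
proof -
  interpret partial_order "div_order W"
    by (rule partial_order_div_order)
  show ?thesis
    by unfold_locales (use least_lcm_elt in auto)
qed

text \<open>Least upper bounds are unique in a partial order, so the one selected by the library is
  the closed form.\<close>

lemma join_div_order:
  assumes "x \<in> S\<^sub>c W" "y \<in> S\<^sub>c W"
  shows "x \<squnion>\<^bsub>div_order W\<^esub> y = lcm_elt W x y"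
proof -
  interpret upper_semilattice "div_order W"
    by (rule upper_semilattice_div_order)
  show ?thesis
  proof (rule joinI)
    fix l
    assume "least (div_order W) l (Upper (div_order W) {x, y})"
    then show "l = lcm_elt W x y"
      using least_lcm_elt[OF assms] by (rule least_unique)
  qed (use assms in simp_all)
qed

text \<open>Multiplicities in \<open>\<union>#\<close> are maxima, and adding a constant commutes
  with \<open>max\<close>.\<close>

lemma union_mset_add_distrib_right: "(u \<union># v) + t = (u + t) \<union># (v + t)"
  by (rule multiset_eqI) simp

text \<open>\<open>Zero\<close> absorbs under both operations, so only words matter. If
  \<open>(u \<union># v) + t\<close> is a subword, so are the intermediate results, its nonempty
  divisors, and nothing collapses. Otherwise both sides are \<open>Zero\<close>, because the right
  side could only be this same word.\<close>

lemma S_mult_lcm_elt_distrib_right: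
  assumes "x \<in> S\<^sub>c W" "y \<in> S\<^sub>c W" "z \<in> S\<^sub>c W"
  shows "S_mult W (lcm_elt W x y) z = lcm_elt W (S_mult W x z) (S_mult W y z)"
proof (cases x; cases y; cases z)
  fix u v t
  assume eq: "x = Word u" "y = Word v" "z = Word t"
  have "u \<union># v \<in> subwords W" "u + t \<in> subwords W" "v + t \<in> subwords W"
    if "(u \<union># v) + t \<in> subwords W"
    using assms eq by (auto intro!: subwords_mono[OF that])
  then show ?thesis
    by (auto simp: eq union_mset_add_distrib_right)
qed auto

lemma ai_semiring_div_order:
  "ai_semiring (S\<^sub>c W) (\<lambda>x y. x \<squnion>\<^bsub>div_order W\<^esub> y) (S_mult W)"
proof -
  interpret upper_semilattice "div_order W"
    by (rule upper_semilattice_div_order)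
  have closed: "x \<squnion>\<^bsub>div_order W\<^esub> y \<in> S\<^sub>c W" if "x \<in> S\<^sub>c W" "y \<in> S\<^sub>c W" for x y
    using that join_closed by simp
  have distrib: "S_mult W (x \<squnion>\<^bsub>div_order W\<^esub> y) z =
      S_mult W x z \<squnion>\<^bsub>div_order W\<^esub> S_mult W y z"
    if "x \<in> S\<^sub>c W" "y \<in> S\<^sub>c W" "z \<in> S\<^sub>c W" for x y z
    using that by (simp add: join_div_order S_mult_lcm_elt_distrib_right)
  show ?thesis
  proof
    fix x y z
    assume S: "x \<in> S\<^sub>c W" "y \<in> S\<^sub>c W" "z \<in> S\<^sub>c W"
    show "x \<squnion>\<^bsub>div_order W\<^esub> y \<squnion>\<^bsub>div_order W\<^esub> z =
        x \<squnion>\<^bsub>div_order W\<^esub> (y \<squnion>\<^bsub>div_order W\<^esub> z)"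
      \<comment> \<open>The library law holds up to the equivalence \<open>eq\<close> of the order,
        which here is equality.\<close>
      using S weak_join_assoc by simp
    \<comment> \<open>Commutativity of the product moves \<open>x\<close> to the right and reduces
      this to \<open>distrib\<close>.\<close>
    show "S_mult W x (y \<squnion>\<^bsub>div_order W\<^esub> z) =
        S_mult W x y \<squnion>\<^bsub>div_order W\<^esub> S_mult W x z"
      using distrib S by (simp add: S_mult_commute[of W x])
  next
    fix x
    assume "x \<in> S\<^sub>c W"
    \<comment> \<open>The join is the supremum of \<open>{x, x}\<close>, which is a
      singleton.\<close>
    then show "x \<squnion>\<^bsub>div_order W\<^esub> x = x"
      using weak_sup_of_singleton by (simp add: join_def)
  qed (use closed distrib join_comm S_mult_assoc in auto)
qed

theorem mainTheorem5:
  fixes X :: "'a set" and W :: "'a multiset set"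
  assumes "countable X" and "infinite X"
    and "W \<subseteq> free_comm_semigroup X" and "W \<noteq> {}"
  shows "upper_semilattice (div_order W)
    \<and> greatest (div_order W) Zero (carrier (div_order W))
    \<and> ai_semiring (S\<^sub>c W) (\<lambda>x y. x \<squnion>\<^bsub>div_order W\<^esub> y) (S_mult W)"
  using upper_semilattice_div_order greatest_div_order ai_semiring_div_order by blast

end
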